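(* Let $\{x_i\}_{i=1}^m$ be a frame for $\mathbb{R}^n$. The following are equivalent: (1) $\{x_i\}_{i=1}^m$ is piecewise scalable. (2) There is an orthogonal projection $P:\mathbb{R}^n\to\mathbb{R}^n$ and real scalars $\{a_i\}_{i=1}^m$ and $\{b_i\}_{i=1}^m$ such that: (a) $\{Px_i\}_{i=1}^m$ and $\{(I-P)x_i\}_{i=1}^m$ are scalable frames, with scaling constants $\{a_i\}_{i=1}^m$ and $\{b_i\}_{i=1}^m$, in the range of $P$ and in the range of $I-P$, respectively (that is, $\{a_iPx_i\}_{i=1}^m$ is a Parseval frame for $P(\mathbb{R}^n)$ and $\{b_i(I-P)x_i\}_{i=1}^m$ is a Parseval frame for $(I-P)(\mathbb{R}^n)$); (b) for all $x\in\mathbb{R}^n$, $$\sum_{i=1}^m a_ib_i\langle x,Px_i\rangle\langle x,(I-P)x_i\rangle=0.$$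
   Context: A finite family $\{x_i\}_{i=1}^m$ in a finite-dimensional real inner product space $H$ is a frame for $H$ if there are constants $0<A\le B<\infty$ with $A\|x\|^2\le\sum_{i=1}^m|\langle x,x_i\rangle|^2\le B\|x\|^2$ for all $x\in H$. It is a Parseval frame for $H$ if $\sum_{i=1}^m|\langle x,x_i\rangle|^2=\|x\|^2$ for all $x\in H$. A frame $\{x_i\}_{i=1}^m$ for $H$ is scalable (in $H$) with scaling constants $c_1,\dots,c_m\in\mathbb{R}$ if $\{c_ix_i\}_{i=1}^m$ is a Parseval frame for $H$. An orthogonal projection is a linear map $P$ with $P\circ P=P$ and $P^*=P$. A frame $\{x_i\}_{i=1}^m$ for $\mathbb{R}^n$ is piecewise scalable if there exist an orthogonal projection $P:\mathbb{R}^n\to\mathbb{R}^n$ and real constants $\{a_i,b_i\}_{i=1}^m$ such that $\{a_iPx_i+b_i(I-P)x_i\}_{i=1}^m$ is a Parseval frame for $\mathbb{R}^n$, where $I$ is the identity on $\mathbb{R}^n$. *)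

theory Defs
  imports "HOL-Analysis.Analysis"
begin

text \<open>
  The finite-dimensional inner product spaces occurring here are \<open>\<real>\<^sup>n\<close> itself and the ranges
  of projections on it, so they are given as subspaces \<open>H\<close> of a Euclidean space, with the inherited
  inner product. A family \<open>x\<^sub>1, \<dots>, x\<^sub>m\<close> is a function on \<open>nat\<close> of which only the values on
  \<open>{1..m}\<close> matter; being a family in \<open>H\<close> is part of the definitions.
\<close>

definition is_frame :: "'a::euclidean_space set \<Rightarrow> nat \<Rightarrow> (nat \<Rightarrow> 'a) \<Rightarrow> bool" where
  "is_frame H m x \<longleftrightarrow>
     subspace H \<and> (\<forall>i\<in>{1..m}. x i \<in> H) \<and>
     (\<exists>A B::real. 0 < A \<and> A \<le> B \<and>
        (\<forall>v\<in>H. A * (norm v)\<^sup>2 \<le> (\<Sum>i=1..m. \<bar>v \<bullet> x i\<bar>\<^sup>2) \<and>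
               (\<Sum>i=1..m. \<bar>v \<bullet> x i\<bar>\<^sup>2) \<le> B * (norm v)\<^sup>2))"

definition is_parseval_frame :: "'a::euclidean_space set \<Rightarrow> nat \<Rightarrow> (nat \<Rightarrow> 'a) \<Rightarrow> bool" where
  "is_parseval_frame H m x \<longleftrightarrow>
     subspace H \<and> (\<forall>i\<in>{1..m}. x i \<in> H) \<and>
     (\<forall>v\<in>H. (\<Sum>i=1..m. \<bar>v \<bullet> x i\<bar>\<^sup>2) = (norm v)\<^sup>2)"

definition scalable_frame_with ::
    "'a::euclidean_space set \<Rightarrow> nat \<Rightarrow> (nat \<Rightarrow> 'a) \<Rightarrow> (nat \<Rightarrow> real) \<Rightarrow> bool" where
  "scalable_frame_with H m x c \<longleftrightarrow>
     is_frame H m x \<and> is_parseval_frame H m (\<lambda>i. c i *\<^sub>R x i)"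

definition orthogonal_projection :: "('a::euclidean_space \<Rightarrow> 'a) \<Rightarrow> bool" where
  "orthogonal_projection P \<longleftrightarrow> linear P \<and> P \<circ> P = P \<and> adjoint P = P"

definition piecewise_scalable :: "nat \<Rightarrow> (nat \<Rightarrow> 'a::euclidean_space) \<Rightarrow> bool" where
  "piecewise_scalable m x \<longleftrightarrow>
     is_frame UNIV m x \<and>
     (\<exists>P (a::nat \<Rightarrow> real) (b::nat \<Rightarrow> real). orthogonal_projection P \<and>
        is_parseval_frame UNIV m (\<lambda>i. a i *\<^sub>R P (x i) + b i *\<^sub>R (x i - P (x i))))"

end

theory Submission
  imports Defs
begin

text \<open>
  Write \<open>Q = I - P\<close>. Expanding the square in the Parseval identity for \<open>a\<^sub>i P x\<^sub>i + b\<^sub>i Q x\<^sub>i\<close> at \<open>v\<close>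
  gives three sums: one depending only on \<open>P v\<close>, one depending only on \<open>Q v\<close>, and twice the cross
  sum in (b). The right-hand side splits by Pythagoras as \<open>|P v|\<^sup>2 + |Q v|\<^sup>2\<close>. Evaluating at \<open>P v\<close> and
  at \<open>Q v\<close> isolates the two Parseval identities on the ranges, and the cross sum is what remains.
\<close>

lemma orthogonal_projection_linear: "orthogonal_projection P \<Longrightarrow> linear P"
  by (simp add: orthogonal_projection_def)

lemma orthogonal_projection_idem: "orthogonal_projection P \<Longrightarrow> P (P v) = P v"
  unfolding orthogonal_projection_def by (metis comp_apply)

lemma orthogonal_projection_inner:
  assumes "orthogonal_projection P"
  shows "v \<bullet> P w = P v \<bullet> w"
  using assms adjoint_clauses(1)[of P v w] by (simp add: orthogonal_projection_def)

text \<open>Makes the situation symmetric: each fact proved below for \<open>P\<close> can be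
  instantiated with \<open>I - P\<close>.\<close>

lemma orthogonal_projection_complement:
  assumes "orthogonal_projection P"
  shows "orthogonal_projection (\<lambda>v. v - P v)"
proof -
  have "linear (\<lambda>v. v - P v)"
    using linear_compose_sub[OF linear_ident orthogonal_projection_linear[OF assms]] .
  moreover have "(\<lambda>v. v - P v) \<circ> (\<lambda>v. v - P v) = (\<lambda>v. v - P v)"
    by (simp add: fun_eq_iff linear_diff[OF orthogonal_projection_linear[OF assms]]
        orthogonal_projection_idem[OF assms])
  moreover have "adjoint (\<lambda>v. v - P v) = (\<lambda>v. v - P v)"
    by (rule adjoint_unique)
      (simp add: inner_diff_left inner_diff_right orthogonal_projection_inner[OF assms])
  ultimately show ?thesis
    by (simp add: orthogonal_projection_def)
qed

lemma orthogonal_projection_pythagoras: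
  assumes "orthogonal_projection P"
  shows "(norm v)\<^sup>2 = (norm (P v))\<^sup>2 + (norm (v - P v))\<^sup>2"
proof -
  have "v \<bullet> P v = P v \<bullet> P v"
    using orthogonal_projection_inner[OF assms, of v "P v"]
    by (simp add: orthogonal_projection_idem[OF assms])
  then show ?thesis
    unfolding power2_norm_eq_inner inner_diff_left inner_diff_right inner_commute[of "P v" v]
    by linarith
qed

text \<open>On \<open>range P\<close> the coefficients against \<open>P (x i)\<close> and against
  \<open>x i\<close> agree, because \<open>P\<close> is self-adjoint and fixes its range. The frame
  bounds of \<open>x\<close> therefore carry over unchanged.\<close>

lemma is_frame_projection:
  assumes P: "orthogonal_projection P" and x: "is_frame UNIV m x"
  shows "is_frame (range P) m (\<lambda>i. P (x i))"
proof -
  have "P v \<bullet> P w = P v \<bullet> w" for v w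
    using orthogonal_projection_inner[OF P, of "P v" w] orthogonal_projection_idem[OF P] by simp
  with x show ?thesis
    unfolding is_frame_def
    by (simp add: linear_subspace_image[OF orthogonal_projection_linear[OF P]]) blast
qed

text \<open>Since \<open>v \<bullet> P w\<close> depends on \<open>v\<close> only through
  \<open>P v\<close>, the identity on the range can be quantified over the whole space, where it can
  be compared with the Parseval identity for the combined family.\<close>

lemma is_parseval_frame_projection_iff:
  assumes P: "orthogonal_projection P"
  shows "is_parseval_frame (range P) m (\<lambda>i. c i *\<^sub>R P (x i)) \<longleftrightarrow>
    (\<forall>v. (\<Sum>i=1..m. (c i * (v \<bullet> P (x i)))\<^sup>2) = (norm (P v))\<^sup>2)"
proof -
  have lin: "linear P"
    using P by (rule orthogonal_projection_linear)
  have "P v \<bullet> P w = v \<bullet> P w" for v w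
    using orthogonal_projection_inner[OF P, of v "P w"] orthogonal_projection_idem[OF P] by simp
  moreover have "c i *\<^sub>R P (x i) \<in> range P" for i
    by (metis lin linear_scale rangeI)
  ultimately show ?thesis
    by (simp add: is_parseval_frame_def linear_subspace_image[OF lin])
qed

lemma is_parseval_frame_split_iff:
  assumes P: "orthogonal_projection P"
  shows "is_parseval_frame UNIV m (\<lambda>i. a i *\<^sub>R P (x i) + b i *\<^sub>R (x i - P (x i))) \<longleftrightarrow>
    is_parseval_frame (range P) m (\<lambda>i. a i *\<^sub>R P (x i)) \<and>
    is_parseval_frame (range (\<lambda>v. v - P v)) m (\<lambda>i. b i *\<^sub>R (x i - P (x i))) \<and>
    (\<forall>v. (\<Sum>i=1..m. a i * b i * (v \<bullet> P (x i)) * (v \<bullet> (x i - P (x i)))) = 0)"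
proof -
  define Q where "Q = (\<lambda>v. v - P v)"
  define S where "S v = (\<Sum>i=1..m. (a i * (v \<bullet> P (x i)))\<^sup>2)" for v
  define T where "T v = (\<Sum>i=1..m. (b i * (v \<bullet> Q (x i)))\<^sup>2)" for v
  define X where "X v = (\<Sum>i=1..m. a i * b i * (v \<bullet> P (x i)) * (v \<bullet> Q (x i)))" for v
  have Q: "orthogonal_projection Q"
    unfolding Q_def using P by (rule orthogonal_projection_complement)
  have PP: "P (P v) = P v" and QQ: "Q (Q v) = Q v" for v
    using P Q by (simp_all add: orthogonal_projection_idem)
  have PQ: "P (Q v) = 0" and QP: "Q (P v) = 0" for v
    by (simp_all add: Q_def linear_diff[OF orthogonal_projection_linear[OF P]] PP)
  note inner = orthogonal_projection_inner[OF P] orthogonal_projection_inner[OF Q]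
  have "(\<Sum>i=1..m. \<bar>v \<bullet> (a i *\<^sub>R P (x i) + b i *\<^sub>R Q (x i))\<bar>\<^sup>2) = S v + T v + 2 * X v" for v
    by (simp add: S_def T_def X_def sum_distrib_left flip: sum.distrib)
      (simp add: power2_eq_square algebra_simps)
  then have full: "is_parseval_frame UNIV m (\<lambda>i. a i *\<^sub>R P (x i) + b i *\<^sub>R Q (x i)) \<longleftrightarrow>
      (\<forall>v. S v + T v + 2 * X v = (norm (P v))\<^sup>2 + (norm (Q v))\<^sup>2)"
    unfolding is_parseval_frame_def Q_def by (simp flip: orthogonal_projection_pythagoras[OF P])
  \<comment> \<open>Self-adjointness moves each projection onto the left argument, where
    \<open>PQ = QP = 0\<close> applies. Every term of \<open>X\<close> has a factor from each
    projection, so \<open>X\<close> vanishes at both points.\<close>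
  have at_P: "S (P v) = S v" "T (P v) = 0" "X (P v) = 0"
    and at_Q: "S (Q v) = 0" "T (Q v) = T v" "X (Q v) = 0" for v
    by (simp_all add: S_def T_def X_def inner PP QQ PQ QP)
  have "(\<forall>v. S v + T v + 2 * X v = (norm (P v))\<^sup>2 + (norm (Q v))\<^sup>2) \<longleftrightarrow>
      (\<forall>v. S v = (norm (P v))\<^sup>2) \<and> (\<forall>v. T v = (norm (Q v))\<^sup>2) \<and> (\<forall>v. X v = 0)"
    (is "?L \<longleftrightarrow> ?R")
  proof
    assume L: ?L
    have S: "S v = (norm (P v))\<^sup>2" for v
      using spec[OF L, of "P v"] by (simp add: at_P PP QP)
    have T: "T v = (norm (Q v))\<^sup>2" for v
      using spec[OF L, of "Q v"] by (simp add: at_Q QQ PQ)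
    \<comment> \<open>Substituting both Parseval identities into the full one leaves
      \<open>2 * X v = 0\<close>.\<close>
    show ?R
      using L by (simp add: S T)
  qed simp
  with full is_parseval_frame_projection_iff[OF P, of m a x]
    is_parseval_frame_projection_iff[OF Q, of m b x]
  show ?thesis
    unfolding S_def T_def X_def Q_def by simp
qed

theorem theorem2p1:
  fixes x :: "nat \<Rightarrow> real ^ 'n" and m :: nat
  assumes "is_frame UNIV m x"
  shows "piecewise_scalable m x \<longleftrightarrow>
    (\<exists>(P :: real ^ 'n \<Rightarrow> real ^ 'n) (a :: nat \<Rightarrow> real) (b :: nat \<Rightarrow> real).
       orthogonal_projection P \<and>
       scalable_frame_with (range P) m (\<lambda>i. P (x i)) a \<and>
       scalable_frame_with (range (\<lambda>v. v - P v)) m (\<lambda>i. x i - P (x i)) b \<and>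
       (\<forall>v. (\<Sum>i=1..m. a i * b i * (v \<bullet> P (x i)) * (v \<bullet> (x i - P (x i)))) = 0))"
  \<comment> \<open>The same \<open>P\<close>, \<open>a\<close>, \<open>b\<close> serve on both
    sides, so the equivalence is rewritten under the existential quantifiers;
    \<open>conj_cong\<close> makes \<open>orthogonal_projection P\<close> available while the other
    conjuncts are simplified.\<close>
  using assms is_frame_projection[OF _ assms]
    is_frame_projection[OF orthogonal_projection_complement assms]
  unfolding piecewise_scalable_def scalable_frame_with_def
  by (simp add: is_parseval_frame_split_iff cong: conj_cong)

end
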